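(* Let $p\ge2$ and $m\ge0$ be integers. Then \begin{align*} &(-1)^{p-1}\{S(2,p+2m+1;p)+S(2,p;p+2m+1)\}\\ &=\sum_{i=1}^{p+2m}\sum_{j=1}^{p+2m+1-i}(-1)^{i+j}\zeta(p+2m+3-i-j)S(p;i+j)-\sum_{i=1}^{p-1}\sum_{j=1}^{p-i}(-1)^{i+j}\zeta(p+2-i-j)S(p+2m+1;i+j)\\ &\quad-(-1)^p\zeta(2)\{\zeta(p)\zeta(p+2m+1)+\zeta(2p+2m+1)\}\\ &\quad+(-1)^p(p+2m+1)S(1,p;p+2m+2)+(-1)^p p\,S(1,p+2m+1;p+1). \end{align*}
   Context: For positive integers $k,n$, $\zeta_n(k)=\sum_{j=1}^n j^{-k}$, $H_n=\zeta_n(1)$, and $\zeta(s)=\sum_{n\ge1}n^{-s}$. For positive integers $a,b,q$ with $q\ge2$: $S(a;q)=\sum_{n\ge1}\zeta_n(a)n^{-q}$ and $S(a,b;q)=\sum_{n\ge1}\zeta_n(a)\zeta_n(b)n^{-q}$. *)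

theory Defs
  imports "HOL-Analysis.Analysis"
begin

definition zeta_partial :: "nat \<Rightarrow> nat \<Rightarrow> real" where
  "zeta_partial n k = (\<Sum>j=1..n. 1 / real j ^ k)"

text \<open>The infinite sums over \<open>n \<ge> 1\<close> are indexed from 0 via \<^const>\<open>Suc\<close>; they converge
  for \<open>s \<ge> 2\<close> and \<open>q \<ge> 2\<close>, the only arguments for which they are meaningful.\<close>

definition zeta :: "nat \<Rightarrow> real" where
  "zeta s = (\<Sum>n. 1 / real (Suc n) ^ s)"

definition euler_sum1 :: "nat \<Rightarrow> nat \<Rightarrow> real" where
  "euler_sum1 a q = (\<Sum>n. zeta_partial (Suc n) a / real (Suc n) ^ q)"

definition euler_sum2 :: "nat \<Rightarrow> nat \<Rightarrow> nat \<Rightarrow> real" where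
  "euler_sum2 a b q =
     (\<Sum>n. zeta_partial (Suc n) a * zeta_partial (Suc n) b / real (Suc n) ^ q)"

end

theory Submission
  imports Defs
begin

text \<open>Put $q = p + 2m + 1$ and $F_a(n) = \sum_{k \ge 1} k^{-a} (k+n)^{-2}$. With $N = n + k$,
  the sum $\sum_n \zeta_n(a) F_b(n)$ equals $\sum_{j,k \ge 1} \sum_{N \ge j+k} j^{-a} k^{-b} N^{-2}$,
  which is symmetric in $a$ and $b$. On the other hand the partial fraction
  decomposition of $x^{-a} (x+n)^{-2}$ expresses $F_a(n)$ through $\zeta_n(2)$, $H_n$ and zeta
  values. Inserting this into $\sum_n \zeta_n(p) F_q(n) = \sum_n \zeta_n(q) F_p(n)$ gives the
  identity; as $p$ and $q$ have opposite parity, the terms $S(p;q)$ and $S(q;p)$ occur with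
  the same sign, and their sum is $\zeta(p) \zeta(q) + \zeta(p+q)$.\<close>

section \<open>Convergence of the Euler sums and the reflection formula\<close>

lemma summable_inverse_Suc_power:
  assumes "s \<ge> 2"
  shows "summable (\<lambda>n. 1 / real (Suc n) ^ s)"
  using inverse_power_summable[OF assms, where 'a=real]
  by (subst (asm) summable_Suc_iff[symmetric]) (simp add: field_simps)

lemma zeta_partial_nonneg: "zeta_partial n a \<ge> 0"
  unfolding zeta_partial_def by (intro sum_nonneg) auto

lemma zeta_partial_Suc:
  "zeta_partial (Suc n) a = zeta_partial n a + 1 / real (Suc n) ^ a"
  by (simp add: zeta_partial_def)

lemma zeta_partial_conv_lessThan:
  "zeta_partial n a = (\<Sum>k<n. 1 / real (Suc k) ^ a)"
  by (induction n) (simp_all add: zeta_partial_def)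

lemma zeta_partial_le_zeta:
  assumes "a \<ge> 2"
  shows "zeta_partial n a \<le> zeta a"
  unfolding zeta_partial_conv_lessThan zeta_def
  by (intro sum_le_suminf summable_inverse_Suc_power assms) auto

lemma zeta_partial_le_self: "zeta_partial n a \<le> real n"
proof -
  have "zeta_partial n a \<le> (\<Sum>k<n. 1)"
    unfolding zeta_partial_conv_lessThan by (intro sum_mono) (simp add: field_simps)
  thus ?thesis by simp
qed

lemma zeta_partial_tendsto:
  assumes "a \<ge> 2"
  shows "(\<lambda>n. zeta_partial n a) \<longlonglongrightarrow> zeta a"
  unfolding zeta_partial_conv_lessThan zeta_def
  by (intro summable_LIMSEQ summable_inverse_Suc_power assms)

lemma summable_over_Suc_power:
  assumes "q \<ge> 2" and "\<And>n. \<bar>f n\<bar> \<le> C"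
  shows "summable (\<lambda>n. f n / real (Suc n) ^ q)"
proof (rule summable_comparison_test')
  show "summable (\<lambda>n. C * (1 / real (Suc n) ^ q))"
    by (intro summable_mult summable_inverse_Suc_power assms)
  show "norm (f n / real (Suc n) ^ q) \<le> C * (1 / real (Suc n) ^ q)" for n
    using assms(2)[of n] by (simp add: divide_right_mono)
qed

lemma euler_sum1_sums:
  assumes "a \<ge> 2" "q \<ge> 2"
  shows "(\<lambda>n. zeta_partial (Suc n) a / real (Suc n) ^ q) sums euler_sum1 a q"
  unfolding euler_sum1_def
  using assms zeta_partial_le_zeta[of a] zeta_partial_nonneg[of _ a]
  by (intro summable_sums summable_over_Suc_power[where C = "zeta a"]) auto

lemma euler_sum2_sums:
  assumes "a \<ge> 2" "b \<ge> 2" "q \<ge> 2"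
  shows "(\<lambda>n. zeta_partial (Suc n) a * zeta_partial (Suc n) b / real (Suc n) ^ q)
           sums euler_sum2 a b q"
  unfolding euler_sum2_def
proof (intro summable_sums summable_over_Suc_power[where C = "zeta a * zeta b"])
  fix n
  have "zeta_partial (Suc n) a * zeta_partial (Suc n) b \<le> zeta a * zeta b"
    using assms by (intro mult_mono' zeta_partial_le_zeta zeta_partial_nonneg)
  thus "\<bar>zeta_partial (Suc n) a * zeta_partial (Suc n) b\<bar> \<le> zeta a * zeta b"
    by (simp add: zeta_partial_nonneg)
qed (use assms in simp)

text \<open>H_n is unbounded, so the estimate with a constant does not apply to it directly. One
  factor n of the denominator is spent on H_n / n <= 1, and the remaining exponent q - 1 is still at
  least 2.\<close>

lemma euler_sum2_harmonic_sums:
  assumes "b \<ge> 2" "q \<ge> 3"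
  shows "(\<lambda>n. zeta_partial (Suc n) 1 * zeta_partial (Suc n) b / real (Suc n) ^ q)
           sums euler_sum2 1 b q"
  unfolding euler_sum2_def
proof (intro summable_sums)
  obtain r where q: "q = Suc r" "r \<ge> 2" using assms by (cases q) auto
  have "summable (\<lambda>n. (zeta_partial (Suc n) 1 / real (Suc n) * zeta_partial (Suc n) b)
          / real (Suc n) ^ r)"
  proof (intro summable_over_Suc_power[where C = "1 * zeta b"])
    fix n
    have "zeta_partial (Suc n) 1 / real (Suc n) \<le> 1"
      using zeta_partial_le_self[of "Suc n" 1] by (simp add: field_simps)
    hence "zeta_partial (Suc n) 1 / real (Suc n) * zeta_partial (Suc n) b \<le> 1 * zeta b"
      using assms by (intro mult_mono' zeta_partial_le_zeta zeta_partial_nonneg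
          divide_nonneg_nonneg) auto
    thus "\<bar>zeta_partial (Suc n) 1 / real (Suc n) * zeta_partial (Suc n) b\<bar> \<le> 1 * zeta b"
      by (simp add: zeta_partial_nonneg abs_mult)
  qed (use q in simp)
  thus "summable (\<lambda>n. zeta_partial (Suc n) 1 * zeta_partial (Suc n) b / real (Suc n) ^ q)"
    by (simp add: q mult_ac)
qed

text \<open>Cut the square of index pairs up to N along its diagonal. Each sum on the left runs over
  one of the closed triangles, so the diagonal is counted twice; this accounts for the term with
  exponent a + b.\<close>

lemma sum_zeta_partial_reflection:
  "(\<Sum>n<N. zeta_partial (Suc n) a / real (Suc n) ^ b)
     + (\<Sum>n<N. zeta_partial (Suc n) b / real (Suc n) ^ a)
   = zeta_partial N a * zeta_partial N b + zeta_partial N (a + b)"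
proof (induction N)
  case (Suc N)
  have alg: "(A + u) * v + (B + v) * u + A * B = (A + u) * (B + v) + u * v"
    for A B u v :: real by (simp add: algebra_simps)
  show ?case
    using Suc alg[of "zeta_partial N a" "1 / real (Suc N) ^ a" "1 / real (Suc N) ^ b" "zeta_partial N b"]
    by (simp add: zeta_partial_Suc power_add algebra_simps add_divide_distrib del: of_nat_Suc)
qed (simp add: zeta_partial_def)

lemma euler_sum1_reflection:
  assumes "a \<ge> 2" "b \<ge> 2"
  shows "euler_sum1 a b + euler_sum1 b a = zeta a * zeta b + zeta (a + b)"
proof (rule LIMSEQ_unique)
  show "(\<lambda>N. (\<Sum>n<N. zeta_partial (Suc n) a / real (Suc n) ^ b)
     + (\<Sum>n<N. zeta_partial (Suc n) b / real (Suc n) ^ a)) \<longlonglongrightarrow> euler_sum1 a b + euler_sum1 b a"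
    using euler_sum1_sums[of a b] euler_sum1_sums[of b a] assms
    by (intro tendsto_add) (simp_all add: sums_def)
  show "(\<lambda>N. (\<Sum>n<N. zeta_partial (Suc n) a / real (Suc n) ^ b)
     + (\<Sum>n<N. zeta_partial (Suc n) b / real (Suc n) ^ a)) \<longlonglongrightarrow> zeta a * zeta b + zeta (a + b)"
    unfolding sum_zeta_partial_reflection
    using assms by (intro tendsto_intros zeta_partial_tendsto) auto
qed

section \<open>Evaluation of F_a(n) by partial fractions\<close>

lemma harmonic_telescope_sums:
  "(\<lambda>k. 1 / real (Suc k) - 1 / (real (Suc k) + real n)) sums zeta_partial n 1"
proof (induction n)
  case (Suc n)
  \<comment> \<open>This is the difference of the series for n + 1 and for n. It telescopes to 1 /
    (n + 1), the increment of H_n.\<close>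
  have "(\<lambda>k. 1 / real (Suc k + n) - 1 / real (Suc (Suc k) + n)) sums (1 / real (Suc 0 + n) - 0)"
  proof (rule telescope_sums')
    have "(\<lambda>k. 1 / real (Suc (k + n))) \<longlonglongrightarrow> 0"
      using LIMSEQ_ignore_initial_segment[OF LIMSEQ_inverse_real_of_nat, of n]
      by (simp add: inverse_eq_divide)
    thus "(\<lambda>k. 1 / real (Suc k + n)) \<longlonglongrightarrow> 0" by simp
  qed
  from sums_add[OF Suc this] show ?case
    by (simp add: zeta_partial_Suc algebra_simps)
qed (simp add: zeta_partial_def)

lemma zeta_tail_sums:
  assumes "s \<ge> 2"
  shows "(\<lambda>k. 1 / (real (Suc k) + real n) ^ s) sums (zeta s - zeta_partial n s)"
  using summable_inverse_Suc_power[OF assms, THEN summable_sums, THEN sums_split_initial_segment, of n]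
  by (simp add: zeta_def zeta_partial_conv_lessThan algebra_simps)

text \<open>By induction on a, dividing by x in each step. The difference 1/x - 1/(x+y) is kept
  together because neither half alone gives a convergent series over x = 1, 2, ...\<close>

lemma partial_fractions_power_times_shifted_square:
  fixes x y :: real
  assumes "x > 0" "y > 0" "a \<ge> 1"
  shows "1 / (x ^ a * (x + y)\<^sup>2) =
     (\<Sum>s = 2..a. (-1) ^ s * real (s - 1) / (y ^ s * x ^ (a + 2 - s)))
     + (-1) ^ a / (y ^ a * (x + y)\<^sup>2)
     - (-1) ^ a * real a / y ^ (a + 1) * (1 / x - 1 / (x + y))"
proof -
  define u where "u = x + y"
  have nz: "x \<noteq> 0" "y \<noteq> 0" "u \<noteq> 0" using assms by (auto simp: u_def)
  \<comment> \<open>Multiplication by 1/x sends 1/u^2 and 1/x - 1/u to combinations of these two and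
    1/x^2, with coefficients depending on y only. Hence the shape of the decomposition is
    preserved.\<close>
  have b1: "1 / x * (1 / u\<^sup>2) = 1 / y\<^sup>2 * (1 / x - 1 / u) - 1 / (y * u\<^sup>2)"
    and b2: "1 / x * (1 / x - 1 / u) = 1 / x\<^sup>2 - 1 / y * (1 / x - 1 / u)"
    using nz by (simp_all add: field_simps power2_eq_square) (simp_all add: u_def algebra_simps)
  show ?thesis
    using \<open>a \<ge> 1\<close> unfolding u_def[symmetric]
  proof (induction a rule: nat_induct_at_least)
    case base
    show ?case using b1 by (simp add: power2_eq_square)
  next
    case (Suc a)
    define T where "T = (\<Sum>s = 2..a. (-1) ^ s * real (s - 1) / (y ^ s * x ^ (a + 2 - s)))"
    define c where "c = (-1) ^ a / y ^ a"
    \<comment> \<open>Dividing by x raises the power of x in each old term. The 1/x^2 produced by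
      \<open>b2\<close> is exactly the new term s = a + 1.\<close>
    have S: "(\<Sum>s = 2..Suc a. (-1) ^ s * real (s - 1) / (y ^ s * x ^ (Suc a + 2 - s)))
       = 1 / x * T - c * real a / y * (1 / x\<^sup>2)"
    proof -
      have "(\<Sum>s = 2..a. (-1) ^ s * real (s - 1) / (y ^ s * x ^ (Suc a + 2 - s))) = 1 / x * T"
        unfolding T_def sum_distrib_left
        by (intro sum.cong) (auto simp: Suc_diff_le)
      thus ?thesis using Suc.hyps by (simp add: c_def mult_ac)
    qed
    have "1 / (x ^ Suc a * u\<^sup>2) = 1 / x * (1 / (x ^ a * u\<^sup>2))" by simp
    also have "\<dots> = 1 / x * (T + c * (1 / u\<^sup>2) - c * real a / y * (1 / x - 1 / u))"
      using Suc.IH by (simp add: T_def c_def mult_ac)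
    also have "\<dots> = 1 / x * T + c * (1 / x * (1 / u\<^sup>2)) - c * real a / y * (1 / x * (1 / x - 1 / u))"
      by (simp only: algebra_simps)
    also have "\<dots> = (1 / x * T - c * real a / y * (1 / x\<^sup>2)) - c / y * (1 / u\<^sup>2)
        + c * real (Suc a) / y\<^sup>2 * (1 / x - 1 / u)"
      unfolding b1 b2 by (simp add: algebra_simps power2_eq_square add_divide_distrib diff_divide_distrib)
    finally show ?case
      unfolding S by (simp add: c_def power2_eq_square mult_ac)
  qed
qed

text \<open>The function F_a(n) of the overview, with k lowered by one.\<close>

definition shifted_zeta :: "nat \<Rightarrow> nat \<Rightarrow> real" where
  "shifted_zeta a n = (\<Sum>k. 1 / (real (Suc k) ^ a * (real (Suc k) + real n)\<^sup>2))"

lemma shifted_zeta_eq: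
  assumes "a \<ge> 1" "n > 0"
  shows "shifted_zeta a n =
     (\<Sum>s = 2..a. (-1) ^ s * real (s - 1) * zeta (a + 2 - s) / real n ^ s)
     + (-1) ^ a * (zeta 2 - zeta_partial n 2) / real n ^ a
     - (-1) ^ a * real a * zeta_partial n 1 / real n ^ (a + 1)"
proof -
  have "(\<lambda>k. (\<Sum>s = 2..a. (-1) ^ s * real (s - 1) / real n ^ s * (1 / real (Suc k) ^ (a + 2 - s)))
     + (-1) ^ a / real n ^ a * (1 / (real (Suc k) + real n)\<^sup>2)
     - (-1) ^ a * real a / real n ^ (a + 1) * (1 / real (Suc k) - 1 / (real (Suc k) + real n)))
    sums ((\<Sum>s = 2..a. (-1) ^ s * real (s - 1) / real n ^ s * zeta (a + 2 - s))
     + (-1) ^ a / real n ^ a * (zeta 2 - zeta_partial n 2)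
     - (-1) ^ a * real a / real n ^ (a + 1) * zeta_partial n 1)"
    \<comment> \<open>The pattern unfolds only the zeta values inside the sum over s;
      \<open>zeta 2\<close> has to stay folded to match \<open>zeta_tail_sums\<close>.\<close>
    unfolding zeta_def[of "a + 2 - _"]
    by (intro sums_add sums_diff sums_sum sums_mult harmonic_telescope_sums zeta_tail_sums
        summable_sums summable_inverse_Suc_power) auto
  also have "(\<lambda>k. (\<Sum>s = 2..a. (-1) ^ s * real (s - 1) / real n ^ s * (1 / real (Suc k) ^ (a + 2 - s)))
     + (-1) ^ a / real n ^ a * (1 / (real (Suc k) + real n)\<^sup>2)
     - (-1) ^ a * real a / real n ^ (a + 1) * (1 / real (Suc k) - 1 / (real (Suc k) + real n)))
    = (\<lambda>k. 1 / (real (Suc k) ^ a * (real (Suc k) + real n)\<^sup>2))"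
    using assms by (subst partial_fractions_power_times_shifted_square) simp_all
  finally show ?thesis
    by (simp add: shifted_zeta_def sums_iff)
qed

section \<open>Rearrangement of the symmetric triple sum\<close>

lemma has_sum_nonneg_sums:
  fixes f :: "nat \<Rightarrow> real"
  assumes "f sums s" "\<And>n. f n \<ge> 0"
  shows "(f has_sum s) UNIV"
  using assms by (intro norm_summable_imp_has_sum) (auto simp: sums_iff)

text \<open>Nonnegativity lets convergence of the iterated sum imply summability over the product
  set. Needed for the majorant of the triple sum and for its inner double sums.\<close>

lemma has_sum_times_nonneg:
  fixes f :: "'a \<Rightarrow> real" and g :: "'b \<Rightarrow> real"
  assumes f: "(f has_sum s) A" and g: "(g has_sum t) B"
    and nonneg: "\<And>x. x \<in> A \<Longrightarrow> f x \<ge> 0" "\<And>y. y \<in> B \<Longrightarrow> g y \<ge> 0"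
  shows "((\<lambda>(x, y). f x * g y) has_sum (s * t)) (A \<times> B)"
proof -
  have inner: "((\<lambda>y. case (x, y) of (x, y) \<Rightarrow> f x * g y) has_sum (f x * t)) B" for x
    using has_sum_cmult_right[OF g, of "f x"] by simp
  have outer: "((\<lambda>x. f x * t) has_sum (s * t)) A"
    by (rule has_sum_cmult_left[OF f])
  have "(\<lambda>(x, y). f x * g y) summable_on A \<times> B"
    by (rule summable_on_SigmaI[OF inner has_sum_imp_summable[OF outer]]) (auto simp: nonneg)
  from has_sum_SigmaI[OF inner outer this] show ?thesis .
qed

lemma shifted_zeta_has_sum:
  assumes "a \<ge> 2"
  shows "((\<lambda>k. 1 / (real (Suc k) ^ a * (real (Suc k) + real n)\<^sup>2)) has_sum shifted_zeta a n) UNIV"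
  unfolding shifted_zeta_def
proof (intro has_sum_nonneg_sums summable_sums)
  show "summable (\<lambda>k. 1 / (real (Suc k) ^ a * (real (Suc k) + real n)\<^sup>2))"
  proof (rule summable_comparison_test'[OF summable_inverse_Suc_power[OF assms]])
    fix k :: nat
    have "1 * 1 \<le> (real (Suc k) + real n) * (real (Suc k) + real n)"
      by (intro mult_mono) auto
    thus "norm (1 / (real (Suc k) ^ a * (real (Suc k) + real n)\<^sup>2)) \<le> 1 / real (Suc k) ^ a"
      by (simp add: divide_simps power2_eq_square)
  qed
qed auto

text \<open>The positive indices $j$ and $k$ are lowered by one, and \<open>d\<close> stands for $N - j - k \ge 0$.\<close>

definition mordell_term :: "nat \<Rightarrow> nat \<Rightarrow> nat \<times> nat \<times> nat \<Rightarrow> real" where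
  "mordell_term a b = (\<lambda>(j, k, d).
     1 / (real (Suc j) ^ a * real (Suc k) ^ b * (real (Suc k) + real (Suc (j + d)))\<^sup>2))"

text \<open>Since N >= d + 1, the term is dominated by a product of three separate powers, whose sum
  is zeta(a) zeta(b) zeta(2).\<close>

lemma mordell_term_summable:
  assumes "a \<ge> 2" "b \<ge> 2"
  shows "mordell_term a b summable_on UNIV"
proof (rule summable_on_comparison_test)
  have *: "((\<lambda>n. 1 / real (Suc n) ^ s) has_sum zeta s) UNIV" if "s \<ge> 2" for s
    unfolding zeta_def using summable_inverse_Suc_power[OF that]
    by (intro has_sum_nonneg_sums summable_sums) auto
  have "((\<lambda>(k, d). 1 / real (Suc k) ^ b * (1 / real (Suc d) ^ 2)) has_sum (zeta b * zeta 2))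
      (UNIV \<times> UNIV)"
    by (intro has_sum_times_nonneg *) (use assms in auto)
  from has_sum_times_nonneg[OF *[OF assms(1)] this]
  have "((\<lambda>(j, k, d). 1 / real (Suc j) ^ a * (1 / real (Suc k) ^ b * (1 / real (Suc d) ^ 2)))
      has_sum (zeta a * (zeta b * zeta 2))) UNIV"
    by (simp add: case_prod_unfold)
  thus "(\<lambda>(j, k, d). 1 / real (Suc j) ^ a * (1 / real (Suc k) ^ b * (1 / real (Suc d) ^ 2)))
      summable_on UNIV"
    by (rule has_sum_imp_summable)
next
  fix x :: "nat \<times> nat \<times> nat"
  obtain j k d where x: "x = (j, k, d)" by (cases x)
  have "(real (Suc d))\<^sup>2 \<le> (real (Suc k) + real (Suc (j + d)))\<^sup>2"
    by (intro power_mono) auto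
  hence "real (Suc j) ^ a * real (Suc k) ^ b * (real (Suc d))\<^sup>2
      \<le> real (Suc j) ^ a * real (Suc k) ^ b * (real (Suc k) + real (Suc (j + d)))\<^sup>2"
    by (intro mult_left_mono) auto
  thus "mordell_term a b x \<le> (case x of (j, k, d) \<Rightarrow>
      1 / real (Suc j) ^ a * (1 / real (Suc k) ^ b * (1 / real (Suc d) ^ 2)))"
    unfolding x mordell_term_def by (auto intro!: divide_left_mono simp: mult.assoc simp del: of_nat_Suc)
qed (auto simp: mordell_term_def)

text \<open>Group the triple sum by n = N - k, which in the lowered indices is j + d.\<close>

lemma zeta_partial_shifted_zeta_sums:
  assumes "a \<ge> 2" "b \<ge> 2"
  shows "(\<lambda>n. zeta_partial (Suc n) a * shifted_zeta b (Suc n)) sums infsum (mordell_term a b) UNIV"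
proof -
  define g where "g = (\<lambda>(n, j, k).
     1 / (real (Suc j) ^ a * real (Suc k) ^ b * (real (Suc k) + real (Suc n))\<^sup>2))"
  define S where "S = (SIGMA n:(UNIV :: nat set). {..n} \<times> (UNIV :: nat set))"
  \<comment> \<open>The inverse recovers d as n - j; this natural subtraction is exact because j <=
    n on \<open>S\<close>.\<close>
  have bij: "bij_betw (\<lambda>(j, k, d). (j + d, j, k)) UNIV S"
    by (rule bij_betwI[where g = "\<lambda>(n, j, k). (j, k, n - j)"]) (auto simp: S_def)
  have "(mordell_term a b has_sum infsum (mordell_term a b) UNIV) UNIV"
    using mordell_term_summable[OF assms] by simp
  hence total: "(g has_sum infsum (mordell_term a b) UNIV) S"
    by (subst has_sum_reindex_bij_betw[OF bij, symmetric])
      (simp add: g_def mordell_term_def case_prod_unfold)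
  \<comment> \<open>For fixed n nothing links j and k any more, so the double sum factors.\<close>
  have inner: "((\<lambda>y. g (n, y)) has_sum (zeta_partial (Suc n) a * shifted_zeta b (Suc n)))
      ({..n} \<times> UNIV)" for n
  proof -
    have "((\<lambda>j. 1 / real (Suc j) ^ a) has_sum zeta_partial (Suc n) a) {..n}"
      by (simp add: has_sum_finite_iff zeta_partial_conv_lessThan lessThan_Suc_atMost)
    moreover note shifted_zeta_has_sum[OF assms(2), of "Suc n"]
    ultimately have "((\<lambda>(j, k). 1 / real (Suc j) ^ a *
          (1 / (real (Suc k) ^ b * (real (Suc k) + real (Suc n))\<^sup>2)))
        has_sum (zeta_partial (Suc n) a * shifted_zeta b (Suc n))) ({..n} \<times> UNIV)"
      by (intro has_sum_times_nonneg) auto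
    thus ?thesis by (simp add: g_def case_prod_unfold mult.assoc)
  qed
  have "((\<lambda>n. zeta_partial (Suc n) a * shifted_zeta b (Suc n)) has_sum
      infsum (mordell_term a b) UNIV) UNIV"
    by (rule has_sum_SigmaD[OF total[unfolded S_def] inner])
  thus ?thesis by (rule has_sum_imp_sums)
qed

text \<open>In lowered indices N = j + k + d + 2, so exchanging j and k keeps N and swaps the
  exponents a and b.\<close>

lemma zeta_partial_shifted_zeta_symmetric:
  assumes "a \<ge> 2" "b \<ge> 2"
  shows "(\<Sum>n. zeta_partial (Suc n) a * shifted_zeta b (Suc n)) =
    (\<Sum>n. zeta_partial (Suc n) b * shifted_zeta a (Suc n))"
proof -
  have "bij (\<lambda>(j, k, d :: nat). (k, j, d) :: nat \<times> nat \<times> nat)"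
    by (rule bij_betwI[where g = "\<lambda>(j, k, d). (k, j, d)"]) auto
  hence "infsum (mordell_term b a) UNIV
      = infsum (\<lambda>x. mordell_term b a ((\<lambda>(j, k, d). (k, j, d)) x)) UNIV"
    by (rule infsum_reindex_bij_betw[symmetric])
  also have "\<dots> = infsum (mordell_term a b) UNIV"
    by (intro infsum_cong) (auto simp: mordell_term_def algebra_simps)
  finally show ?thesis
    using zeta_partial_shifted_zeta_sums[of a b] zeta_partial_shifted_zeta_sums[of b a] assms
    by (simp add: sums_iff)
qed

section \<open>Comparison of the two evaluations\<close>

lemma suminf_zeta_partial_shifted_zeta:
  assumes "a \<ge> 2" "b \<ge> 2"
  shows "(\<Sum>n. zeta_partial (Suc n) a * shifted_zeta b (Suc n)) =
     (\<Sum>s = 2..b. real (s - 1) * ((-1) ^ s * zeta (b + 2 - s) * euler_sum1 a s))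
     + (-1) ^ b * (zeta 2 * euler_sum1 a b - euler_sum2 2 a b)
     - (-1) ^ b * real b * euler_sum2 1 a (b + 1)"
proof -
  have "(\<lambda>n. (\<Sum>s = 2..b. real (s - 1) * ((-1) ^ s * zeta (b + 2 - s)
              * (zeta_partial (Suc n) a / real (Suc n) ^ s)))
     + (-1) ^ b * (zeta 2 * (zeta_partial (Suc n) a / real (Suc n) ^ b)
          - zeta_partial (Suc n) 2 * zeta_partial (Suc n) a / real (Suc n) ^ b)
     - (-1) ^ b * real b * (zeta_partial (Suc n) 1 * zeta_partial (Suc n) a / real (Suc n) ^ (b + 1)))
    sums ((\<Sum>s = 2..b. real (s - 1) * ((-1) ^ s * zeta (b + 2 - s) * euler_sum1 a s))
     + (-1) ^ b * (zeta 2 * euler_sum1 a b - euler_sum2 2 a b)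
     - (-1) ^ b * real b * euler_sum2 1 a (b + 1))"
    \<comment> \<open>The harmonic factor comes with the exponent b + 1 >= 3, as
      \<open>euler_sum2_harmonic_sums\<close> requires.\<close>
    using assms
    by (intro sums_add sums_diff sums_sum sums_mult euler_sum1_sums euler_sum2_sums
        euler_sum2_harmonic_sums) auto
  also have "(\<lambda>n. (\<Sum>s = 2..b. real (s - 1) * ((-1) ^ s * zeta (b + 2 - s)
              * (zeta_partial (Suc n) a / real (Suc n) ^ s)))
     + (-1) ^ b * (zeta 2 * (zeta_partial (Suc n) a / real (Suc n) ^ b)
          - zeta_partial (Suc n) 2 * zeta_partial (Suc n) a / real (Suc n) ^ b)
     - (-1) ^ b * real b * (zeta_partial (Suc n) 1 * zeta_partial (Suc n) a / real (Suc n) ^ (b + 1)))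
    = (\<lambda>n. zeta_partial (Suc n) a * shifted_zeta b (Suc n))"
  proof
    fix n
    show "(\<Sum>s = 2..b. real (s - 1) * ((-1) ^ s * zeta (b + 2 - s)
              * (zeta_partial (Suc n) a / real (Suc n) ^ s)))
     + (-1) ^ b * (zeta 2 * (zeta_partial (Suc n) a / real (Suc n) ^ b)
          - zeta_partial (Suc n) 2 * zeta_partial (Suc n) a / real (Suc n) ^ b)
     - (-1) ^ b * real b * (zeta_partial (Suc n) 1 * zeta_partial (Suc n) a / real (Suc n) ^ (b + 1))
     = zeta_partial (Suc n) a * shifted_zeta b (Suc n)"
      using assms
      by (simp add: shifted_zeta_eq ring_distribs sum_distrib_left diff_divide_distrib mult_ac
          del: of_nat_Suc power_Suc)
  qed
  finally show ?thesis by (simp add: sums_iff)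
qed

text \<open>A number s is i + j with i, j >= 1 in s - 1 ways. This matches the double sums of the
  theorem with the weights s - 1 from the partial fractions. Raising a by one lengthens every row by
  an entry with i + j = a + 1.\<close>

lemma sum_triangle_by_diagonals:
  fixes g :: "nat \<Rightarrow> real"
  shows "(\<Sum>i = 1..a - 1. \<Sum>j = 1..a - i. g (i + j)) = (\<Sum>s = 2..a. real (s - 1) * g s)"
proof (induction a)
  case (Suc a)
  show ?case
  proof (cases "a \<ge> 1")
    case True
    have "(\<Sum>i = 1..a. \<Sum>j = 1..Suc a - i. g (i + j))
        = (\<Sum>i = 1..a. (\<Sum>j = 1..a - i. g (i + j)) + g (Suc a))"
      by (intro sum.cong) (auto simp: Suc_diff_le)
    also have "\<dots> = (\<Sum>i = 1..a. \<Sum>j = 1..a - i. g (i + j)) + real a * g (Suc a)"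
      by (simp add: sum.distrib)
    \<comment> \<open>The row i = a is empty, as j would run from 1 to 0.\<close>
    also have "(\<Sum>i = 1..a. \<Sum>j = 1..a - i. g (i + j)) = (\<Sum>i = 1..a - 1. \<Sum>j = 1..a - i. g (i + j))"
      using True by (intro sum.mono_neutral_right) auto
    finally show ?thesis using Suc.IH True by simp
  qed auto
qed simp

theorem theorem3p1:
  fixes p m :: nat
  assumes "p \<ge> 2"
  shows "(-1) ^ (p - 1) *
           (euler_sum2 2 (p + 2*m + 1) p + euler_sum2 2 p (p + 2*m + 1))
       = (\<Sum>i = 1..p + 2*m. \<Sum>j = 1..p + 2*m + 1 - i.
            (-1) ^ (i + j) * zeta (p + 2*m + 3 - i - j) * euler_sum1 p (i + j))
       - (\<Sum>i = 1..p - 1. \<Sum>j = 1..p - i.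
            (-1) ^ (i + j) * zeta (p + 2 - i - j) * euler_sum1 (p + 2*m + 1) (i + j))
       - (-1) ^ p * zeta 2 * (zeta p * zeta (p + 2*m + 1) + zeta (2*p + 2*m + 1))
       + (-1) ^ p * real (p + 2*m + 1) * euler_sum2 1 p (p + 2*m + 2)
       + (-1) ^ p * real p * euler_sum2 1 (p + 2*m + 1) (p + 1)"
proof -
  define q where "q = p + 2*m + 1"
  have q: "q \<ge> 2" "p + 2*m = q - 1" "p + 2*m + 3 = q + 2" "p + 2*m + 2 = q + 1"
    "2*p + 2*m + 1 = p + q"
    using assms by (auto simp: q_def)
  \<comment> \<open>q - p = 2m + 1 is odd.\<close>
  have sgn: "(-1 :: real) ^ q = - ((-1) ^ p)" "(-1 :: real) ^ (p - 1) = - ((-1) ^ p)"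
    using assms by (auto simp: q_def power_add uminus_power_if)
  have refl: "euler_sum1 p q + euler_sum1 q p = zeta p * zeta q + zeta (p + q)"
    using euler_sum1_reflection assms q(1) by blast
  \<comment> \<open>Used for (a, b) = (q, p) and (p, q). The summand is visibly a function of i + j
    once the two subtractions are merged.\<close>
  have triangle: "(\<Sum>i = 1..a - 1. \<Sum>j = 1..a - i.
        (-1) ^ (i + j) * zeta (a + 2 - i - j) * euler_sum1 b (i + j))
      = (\<Sum>s = 2..a. real (s - 1) * ((-1) ^ s * zeta (a + 2 - s) * euler_sum1 b s))" for a b
    using sum_triangle_by_diagonals[of "\<lambda>s. (-1) ^ s * zeta (a + 2 - s) * euler_sum1 b s" a]
    by (simp only: diff_diff_left)
  have sym: "(\<Sum>s = 2..q. real (s - 1) * ((-1) ^ s * zeta (q + 2 - s) * euler_sum1 p s))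
        + (-1) ^ q * (zeta 2 * euler_sum1 p q - euler_sum2 2 p q)
        - (-1) ^ q * real q * euler_sum2 1 p (q + 1)
      = (\<Sum>s = 2..p. real (s - 1) * ((-1) ^ s * zeta (p + 2 - s) * euler_sum1 q s))
        + (-1) ^ p * (zeta 2 * euler_sum1 q p - euler_sum2 2 q p)
        - (-1) ^ p * real p * euler_sum2 1 q (p + 1)"
    using zeta_partial_shifted_zeta_symmetric[of p q] assms q(1)
    by (simp only: suminf_zeta_partial_shifted_zeta)
  show ?thesis
    \<comment> \<open>The rule for \<open>p + 2*m\<close> must wait, since its left side also occurs
      inside \<open>p + 2*m + 3\<close> and \<open>p + 2*m + 2\<close>.\<close>
    unfolding q_def[symmetric] q(3-5)
    \<comment> \<open>Reading \<open>refl\<close> backwards replaces the zeta products by the two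
      Euler sums occurring in \<open>sym\<close>.\<close>
    unfolding q(2) triangle sgn refl[symmetric]
    using sym[unfolded sgn] by argo
qed

end
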